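(* Let $h$ be a smooth function of $t$ on an open interval with $h,h',h''$ nowhere zero. For a smooth function $w=w(t)$ put $$u=\Big[\Big(\frac{2x}{h'}-\frac{y^2}{2h}\Big)w(t)-\frac{y^2}{2h}\Big]\frac{h''}2.$$ Then $u$ is invariant under both $\mathbf v_0$ and $\mathbf y_h$, and there are functions $\alpha(t),\beta(t),\gamma(t)$ of time (depending only on $h$) such that $u$ solves the ZK equation $u_{xt}-(uu_x)_x-u_{yy}=0$ if and only if $w$ satisfies the generalized Riccati equation $$w'+\alpha(t)w^2+\beta(t)w+\gamma(t)=0.$$
   Context: $\mathbf v_0=2x\partial_x+y\partial_y+2u\partial_u$ and $\mathbf y_h=\tfrac12 yh'\partial_x+h\partial_y-\tfrac12 yh''\partial_u$ are vector fields on $(t,x,y,u)$-space; primes denote $d/dt$. A function $u(t,x,y)$ is invariant under a vector field if the field is tangent to its graph. *)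

theory Defs
  imports "HOL-Analysis.Analysis"
begin

text \<open>Meant for open \<open>I\<close>: there the iterated derivatives at points of \<open>I\<close> only depend on
  the values of \<open>f\<close> on \<open>I\<close>.\<close>

definition smooth_on :: "real set \<Rightarrow> (real \<Rightarrow> real) \<Rightarrow> bool" where
  "smooth_on I f \<longleftrightarrow> (\<forall>n. \<forall>t\<in>I. (deriv ^^ n) f differentiable (at t))"

text \<open>A point of the base space is \<open>(t, x, y)\<close>, a point of the total space is \<open>(t, x, y, u)\<close>;
  a vector field \<open>a \<partial>\<^sub>t + b \<partial>\<^sub>x + c \<partial>\<^sub>y + d \<partial>\<^sub>u\<close> is the map sending a point to
  its components \<open>(a, b, c, d)\<close>.\<close>

type_synonym base = "real \<times> real \<times> real"
type_synonym total = "real \<times> real \<times> real \<times> real"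

definition v0 :: "total \<Rightarrow> total" where
  "v0 = (\<lambda>(t, x, y, u). (0, 2 * x, y, 2 * u))"

definition y_field :: "(real \<Rightarrow> real) \<Rightarrow> total \<Rightarrow> total" where
  "y_field h = (\<lambda>(t, x, y, u).
     (0, 1/2 * y * deriv h t, h t, - (1/2) * y * deriv (deriv h) t))"

text \<open>The tangent space of the graph of \<open>u\<close> over \<open>p\<close> is the graph of the Frechet
  derivative of \<open>u\<close> at \<open>p\<close>.\<close>

definition invariant_under :: "(total \<Rightarrow> total) \<Rightarrow> base set \<Rightarrow> (base \<Rightarrow> real) \<Rightarrow> bool" where
  "invariant_under X D u \<longleftrightarrow>
     (\<forall>(t, x, y)\<in>D. \<exists>u'. (u has_derivative u') (at (t, x, y)) \<and>
        X (t, x, y, u (t, x, y)) \<in> {(a, b, c, u' (a, b, c)) |a b c. True})"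

definition pd_t :: "(base \<Rightarrow> real) \<Rightarrow> base \<Rightarrow> real" where
  "pd_t f = (\<lambda>(t, x, y). deriv (\<lambda>s. f (s, x, y)) t)"

definition pd_x :: "(base \<Rightarrow> real) \<Rightarrow> base \<Rightarrow> real" where
  "pd_x f = (\<lambda>(t, x, y). deriv (\<lambda>s. f (t, s, y)) x)"

definition pd_y :: "(base \<Rightarrow> real) \<Rightarrow> base \<Rightarrow> real" where
  "pd_y f = (\<lambda>(t, x, y). deriv (\<lambda>s. f (t, x, s)) y)"

text \<open>Classical solutions. The differentiability clauses assert that every partial derivative
  in the equation exists, as \<open>deriv\<close> is total.\<close>

definition solves_ZK :: "base set \<Rightarrow> (base \<Rightarrow> real) \<Rightarrow> bool" where
  "solves_ZK D u \<longleftrightarrow>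
     (\<forall>(t, x, y)\<in>D.
        (\<lambda>s. u (t, s, y)) differentiable (at x) \<and>
        (\<lambda>s. u (t, x, s)) differentiable (at y) \<and>
        (\<lambda>s. pd_x u (s, x, y)) differentiable (at t) \<and>
        (\<lambda>s. u (t, s, y) * pd_x u (t, s, y)) differentiable (at x) \<and>
        (\<lambda>s. pd_y u (t, x, s)) differentiable (at y) \<and>
        pd_t (pd_x u) (t, x, y) - pd_x (\<lambda>p. u p * pd_x u p) (t, x, y)
          - pd_y (pd_y u) (t, x, y) = 0)"

definition ansatz :: "(real \<Rightarrow> real) \<Rightarrow> (real \<Rightarrow> real) \<Rightarrow> base \<Rightarrow> real" where
  "ansatz h w = (\<lambda>(t, x, y).
     ((2 * x / deriv h t - y\<^sup>2 / (2 * h t)) * w t - y\<^sup>2 / (2 * h t)) * (deriv (deriv h) t / 2))"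

end

theory Submission
  imports Defs
begin

text \<open>The function \<open>u\<close> has the form \<open>A(t) x - B(t) y\<^sup>2\<close>, so the ZK equation is free of \<open>x\<close> and
  \<open>y\<close> and reads \<open>A' - A\<^sup>2 + 2 B = 0\<close>. Here \<open>A = w h''/h'\<close> and \<open>B = (w + 1) h''/(4 h)\<close>, and
  multiplication by \<open>h'/h''\<close> turns this into the Riccati equation.\<close>

definition linquad :: "(real \<Rightarrow> real) \<Rightarrow> (real \<Rightarrow> real) \<Rightarrow> base \<Rightarrow> real" where
  "linquad A B = (\<lambda>(t, x, y). A t * x - B t * y\<^sup>2)"

text \<open>Collecting the coefficients of \<open>x\<close> and \<open>y\<^sup>2\<close> gives this.
  It is an identity of total functions: where \<open>h t\<close> or \<open>deriv h t\<close>
  vanishes, division by zero returns 0 on both sides, hence the case split.\<close>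

lemma ansatz_eq_linquad:
  "ansatz h w = linquad (\<lambda>t. w t * deriv (deriv h) t / deriv h t)
                        (\<lambda>t. (w t + 1) * deriv (deriv h) t / (4 * h t))"
proof (rule ext, clarify)
  fix t x y
  show "ansatz h w (t, x, y) = linquad (\<lambda>t. w t * deriv (deriv h) t / deriv h t)
      (\<lambda>t. (w t + 1) * deriv (deriv h) t / (4 * h t)) (t, x, y)"
    by (cases "h t = 0"; cases "deriv h t = 0") (simp_all add: ansatz_def linquad_def field_simps)
qed

text \<open>Stated as an equality of functions so that it can be rewritten inside a further partial
  derivative.\<close>

lemma pd_x_linquad: "pd_x (linquad A B) = (\<lambda>p. A (fst p))"
  by (auto simp: pd_x_def linquad_def fun_eq_iff intro!: DERIV_imp_deriv derivative_eq_intros)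

lemma pd_y_linquad: "pd_y (linquad A B) = (\<lambda>p. - (2 * B (fst p) * snd (snd p)))"
  by (auto simp: pd_y_def linquad_def fun_eq_iff intro!: DERIV_imp_deriv derivative_eq_intros)

lemma has_derivative_linquad:
  assumes A: "(A has_real_derivative A') (at t)" and B: "(B has_real_derivative B') (at t)"
  shows "(linquad A B has_derivative
           (\<lambda>(a, b, c). (A' * x - B' * y\<^sup>2) * a + A t * b - 2 * B t * y * c)) (at (t, x, y))"
proof -
  have "((\<lambda>p. A (fst p)) has_derivative (\<lambda>q. A' * fst q)) (at (t, x, y))"
    using has_derivative_compose[OF has_derivative_fst[OF has_derivative_ident], of A "(*) A'" "(t, x, y)" UNIV] A
    by (simp add: has_field_derivative_def)
  moreover have "((\<lambda>p. B (fst p)) has_derivative (\<lambda>q. B' * fst q)) (at (t, x, y))"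
    using has_derivative_compose[OF has_derivative_fst[OF has_derivative_ident], of B "(*) B'" "(t, x, y)" UNIV] B
    by (simp add: has_field_derivative_def)
  ultimately have "((\<lambda>p. A (fst p) * fst (snd p) - B (fst p) * (snd (snd p))\<^sup>2) has_derivative
      (\<lambda>(a, b, c). (A' * x - B' * y\<^sup>2) * a + A t * b - 2 * B t * y * c)) (at (t, x, y))"
    by (auto intro!: derivative_eq_intros simp: fun_eq_iff algebra_simps)
  then show ?thesis
    by (simp add: linquad_def case_prod_unfold)
qed

text \<open>For a field with zero \<open>t\<close>-component, tangency to the graph means that its
  \<open>u\<close>-component is \<open>b\<close> times the \<open>x\<close>-derivative plus
  \<open>c\<close> times the \<open>y\<close>-derivative; the derivatives of \<open>A\<close> and
  \<open>B\<close> drop out.\<close>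

lemma invariant_under_linquad:
  assumes "\<And>t. t \<in> I \<Longrightarrow> A differentiable (at t)" "\<And>t. t \<in> I \<Longrightarrow> B differentiable (at t)"
    and "\<And>t x y. t \<in> I \<Longrightarrow> \<exists>b c. X (t, x, y, linquad A B (t, x, y)) = (0, b, c, A t * b - 2 * B t * y * c)"
  shows "invariant_under X (I \<times> UNIV \<times> UNIV) (linquad A B)"
  unfolding invariant_under_def
proof (clarify)
  fix t x y assume t: "t \<in> I"
  obtain A' B' where "(A has_real_derivative A') (at t)" "(B has_real_derivative B') (at t)"
    using assms(1,2)[OF t] by (auto simp: real_differentiable_def)
  note D = has_derivative_linquad[OF this, of x y]
  obtain b c where "X (t, x, y, linquad A B (t, x, y)) = (0, b, c, A t * b - 2 * B t * y * c)"
    using assms(3)[OF t] by blast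
  with D show "\<exists>u'. (linquad A B has_derivative u') (at (t, x, y)) \<and>
      X (t, x, y, linquad A B (t, x, y)) \<in> {(a, b, c, u' (a, b, c)) |a b c. True}"
    by (intro exI[of _ "\<lambda>(a, b, c). (A' * x - B' * y\<^sup>2) * a + A t * b - 2 * B t * y * c"]) auto
qed

text \<open>Since \<open>u_x = A\<close> depends on \<open>t\<close> only, the three terms of the
  equation are \<open>u_xt = A'\<close>, \<open>(u u_x)_x = A\<^sup>2\<close> and
  \<open>u_yy = -2 B\<close>. The only derivative in \<open>t\<close> falls on
  \<open>A\<close>.\<close>

lemma solves_ZK_linquad:
  assumes A: "\<And>t. t \<in> I \<Longrightarrow> A differentiable (at t)"
  shows "solves_ZK (I \<times> UNIV \<times> UNIV) (linquad A B) \<longleftrightarrow>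
         (\<forall>t\<in>I. deriv A t - (A t)\<^sup>2 + 2 * B t = 0)"
proof -
  have x: "((\<lambda>s. linquad A B (t, s, y)) has_real_derivative A t) (at x)"
   and y: "((\<lambda>s. linquad A B (t, x, s)) has_real_derivative - 2 * B t * y) (at y)"
   and ux: "((\<lambda>s. linquad A B (t, s, y) * A t) has_real_derivative (A t)\<^sup>2) (at x)"
   and yy: "((\<lambda>s. - (2 * B t * s)) has_real_derivative - (2 * B t)) (at y)" for t x y
    by (auto simp: linquad_def power2_eq_square intro!: derivative_eq_intros)
  have diff: "(\<lambda>s. linquad A B (t, s, y)) differentiable (at x)"
    "(\<lambda>s. linquad A B (t, x, s)) differentiable (at y)"
    "(\<lambda>s. linquad A B (t, s, y) * A t) differentiable (at x)"
    "(\<lambda>s. - (2 * B t * s)) differentiable (at y)" for t x y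
    using x y ux yy real_differentiable_def by blast+
  have "pd_t (\<lambda>p. A (fst p)) (t, x, y) = deriv A t"
    "pd_x (\<lambda>p. linquad A B p * A (fst p)) (t, x, y) = (A t)\<^sup>2"
    "pd_y (\<lambda>p. - (2 * B (fst p) * snd (snd p))) (t, x, y) = - (2 * B t)" for t x y
    using DERIV_imp_deriv[OF ux] DERIV_imp_deriv[OF yy] by (simp_all add: pd_t_def pd_x_def pd_y_def)
  with diff A show ?thesis
    by (auto simp: solves_ZK_def pd_x_linquad pd_y_linquad)
qed

lemma smooth_on_has_deriv:
  assumes "smooth_on I f" "t \<in> I"
  shows "((deriv ^^ n) f has_real_derivative (deriv ^^ Suc n) f t) (at t)"
  using assms by (simp add: smooth_on_def DERIV_deriv_iff_real_differentiable)

theorem mainTheorem12: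
  fixes I :: "real set" and h :: "real \<Rightarrow> real"
  assumes "open I" and "is_interval I"
    and "smooth_on I h"
    and "\<forall>t\<in>I. h t \<noteq> 0 \<and> deriv h t \<noteq> 0 \<and> deriv (deriv h) t \<noteq> 0"
  shows "(\<forall>w. smooth_on I w \<longrightarrow>
            invariant_under v0 (I \<times> UNIV \<times> UNIV) (ansatz h w) \<and>
            invariant_under (y_field h) (I \<times> UNIV \<times> UNIV) (ansatz h w)) \<and>
         (\<exists>\<alpha> \<beta> \<gamma> :: real \<Rightarrow> real. \<forall>w. smooth_on I w \<longrightarrow>
            (solves_ZK (I \<times> UNIV \<times> UNIV) (ansatz h w) \<longleftrightarrow>
             (\<forall>t\<in>I. deriv w t + \<alpha> t * (w t)\<^sup>2 + \<beta> t * w t + \<gamma> t = 0)))"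
proof -
  define h1 h2 h3 where "h1 = deriv h" and "h2 = deriv h1" and "h3 = deriv h2"
  have nz: "h t \<noteq> 0" "h1 t \<noteq> 0" "h2 t \<noteq> 0" if "t \<in> I" for t
    using assms(4) that by (auto simp: h1_def h2_def)
  have dh: "(h has_real_derivative h1 t) (at t)" "(h1 has_real_derivative h2 t) (at t)"
    "(h2 has_real_derivative h3 t) (at t)" if "t \<in> I" for t
    using smooth_on_has_deriv[OF assms(3) that, of 0] smooth_on_has_deriv[OF assms(3) that, of 1]
      smooth_on_has_deriv[OF assms(3) that, of 2]
    by (simp_all add: h1_def h2_def h3_def numeral_2_eq_2)
  define A where "A w t = w t * h2 t / h1 t" for w t
  define B where "B w t = (w t + 1) * h2 t / (4 * h t)" for w t
  have ansatz: "ansatz h w = linquad (A w) (B w)" for w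
    unfolding ansatz_eq_linquad A_def B_def h1_def h2_def ..
  have dA: "(A w has_real_derivative
        deriv w t * h2 t / h1 t + w t * (h3 t / h1 t - (h2 t)\<^sup>2 / (h1 t)\<^sup>2)) (at t)"
    and dB: "B w differentiable (at t)" if w: "smooth_on I w" and t: "t \<in> I" for w t
  proof -
    note dw = smooth_on_has_deriv[OF w t, of 0, simplified]
    show "(A w has_real_derivative
        deriv w t * h2 t / h1 t + w t * (h3 t / h1 t - (h2 t)\<^sup>2 / (h1 t)\<^sup>2)) (at t)"
      unfolding A_def using nz[OF t]
      by (auto intro!: derivative_eq_intros dw dh[OF t] simp: field_simps power2_eq_square)
    show "B w differentiable (at t)"
      unfolding B_def real_differentiable_def using nz[OF t]
      by (auto intro!: exI derivative_eq_intros dw dh[OF t])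
  qed
  have A_diff: "A w differentiable (at t)" if "smooth_on I w" "t \<in> I" for w t
    using dA[OF that] real_differentiable_def by blast
  \<comment> \<open>Euler's identity: \<open>A x - B y\<^sup>2\<close> is homogeneous of degree 2
    when \<open>x\<close> has weight 2 and \<open>y\<close> weight 1.\<close>
  have v0: "invariant_under v0 (I \<times> UNIV \<times> UNIV) (ansatz h w)" if "smooth_on I w" for w
    unfolding ansatz
    by (rule invariant_under_linquad[OF A_diff[OF that] dB[OF that]])
      (auto simp: v0_def linquad_def power2_eq_square algebra_simps)
  have yh: "invariant_under (y_field h) (I \<times> UNIV \<times> UNIV) (ansatz h w)" if "smooth_on I w" for w
    unfolding ansatz
  proof (rule invariant_under_linquad[OF A_diff[OF that] dB[OF that]])
    fix t x y assume "t \<in> I"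
    note nz = nz[OF this]
    \<comment> \<open>The contributions of \<open>w\<close> cancel:
      \<open>A y h'/2 = w y h''/2\<close> and \<open>2 B y h = (w + 1) y h''/2\<close>, whose
      difference is \<open>- y h''/2\<close>.\<close>
    have "y_field h (t, x, y, linquad (A w) (B w) (t, x, y)) =
        (0, y * h1 t / 2, h t, A w t * (y * h1 t / 2) - 2 * B w t * y * h t)"
      using nz by (simp add: y_field_def A_def B_def field_simps flip: h1_def h2_def)
    then show "\<exists>b c. y_field h (t, x, y, linquad (A w) (B w) (t, x, y)) =
        (0, b, c, A w t * b - 2 * B w t * y * c)"
      by blast
  qed
  \<comment> \<open>The coefficients come from multiplying \<open>A' - A\<^sup>2 + 2 B\<close> by
    \<open>h'/h''\<close>. The term \<open>2 B\<close> becomes \<open>(w + 1) h'/(2 h)\<close>, so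
    it contributes equally to \<beta> and \<gamma>.\<close>
  define \<alpha> where "\<alpha> t = - h2 t / h1 t" for t
  define \<beta> where "\<beta> t = h3 t / h2 t - h2 t / h1 t + h1 t / (2 * h t)" for t
  define \<gamma> where "\<gamma> t = h1 t / (2 * h t)" for t
  have ZK: "solves_ZK (I \<times> UNIV \<times> UNIV) (ansatz h w) \<longleftrightarrow>
      (\<forall>t\<in>I. deriv w t + \<alpha> t * (w t)\<^sup>2 + \<beta> t * w t + \<gamma> t = 0)" if w: "smooth_on I w" for w
  proof -
    have "deriv (A w) t - (A w t)\<^sup>2 + 2 * B w t =
        h2 t / h1 t * (deriv w t + \<alpha> t * (w t)\<^sup>2 + \<beta> t * w t + \<gamma> t)" if t: "t \<in> I" for t
      unfolding DERIV_imp_deriv[OF dA[OF w t]] A_def B_def \<alpha>_def \<beta>_def \<gamma>_def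
      using nz[OF t] by (simp add: field_simps power2_eq_square)
    \<comment> \<open>The factor \<open>h''/h'\<close> vanishes nowhere on \<open>I\<close>, so the
      two equations are equivalent pointwise.\<close>
    then show ?thesis
      using solves_ZK_linquad[of I "A w" "B w"] A_diff[OF w] nz by (simp add: ansatz)
  qed
  show ?thesis
    using v0 yh ZK by blast
qed

end
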